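(* Let $(X,\tau,\mathcal{I})$ be an ideal topological space which is a Hayashi-Samuels space, let $(Y,\sigma)$ be a topological space, and let $f\colon X\to Y$ be a function. Then the following conditions are equivalent: (1) $f\colon (X,\tau)\to(Y,\sigma)$ is continuous. (2) $f\colon (X,\tau,\mathcal{I})\to(Y,\sigma)$ is pre-$\mathcal{I}$-continuous and $\mathcal{I}$-$LC$-continuous.
   Context: An ideal on a set $X$ is a nonempty collection $\mathcal{I}$ of subsets of $X$ such that (a) $A\in\mathcal{I}$ and $B\subseteq A$ imply $B\in\mathcal{I}$, and (b) $A,B\in\mathcal{I}$ imply $A\cup B\in\mathcal{I}$. An ideal topological space $(X,\tau,\mathcal{I})$ is a topological space $(X,\tau)$ with an ideal $\mathcal{I}$ on $X$. For $A\subseteq X$, the local function of $A$ is $A^{*}=\{x\in X : U\cap A\notin\mathcal{I}\text{ for every }U\in\tau\text{ with }x\in U\}$, and $\mathrm{Cl}^{*}(A)=A\cup A^{*}$. $\mathrm{Int}$ denotes interior with respect to $\tau$. The space $(X,\tau,\mathcal{I})$ is a Hayashi-Samuels space if $X=X^{*}$. A set $A\subseteq X$ is pre-$\mathcal{I}$-open if $A\subseteq\mathrm{Int}(\mathrm{Cl}^{*}(A))$. A set $V\subseteq X$ is $\star$-perfect if $V=V^{*}$. A set $A\subseteq X$ is $\mathcal{I}$-locally closed if $A=U\cap V$ for some $U\in\tau$ and some $\star$-perfect $V$. A function $f\colon(X,\tau,\mathcal{I})\to(Y,\sigma)$ is pre-$\mathcal{I}$-continuous (resp. $\mathcal{I}$-$LC$-continuous)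 if $f^{-1}(V)$ is pre-$\mathcal{I}$-open (resp. $\mathcal{I}$-locally closed) for every $V\in\sigma$. *)

theory Defs
  imports "HOL-Analysis.Abstract_Topology"
begin

definition ideal_on :: "'a set \<Rightarrow> 'a set set \<Rightarrow> bool" where
  "ideal_on S \<I> \<longleftrightarrow>
     \<I> \<subseteq> Pow S \<and> \<I> \<noteq> {} \<and>
     (\<forall>A B. A \<in> \<I> \<longrightarrow> B \<subseteq> A \<longrightarrow> B \<in> \<I>) \<and>
     (\<forall>A B. A \<in> \<I> \<longrightarrow> B \<in> \<I> \<longrightarrow> A \<union> B \<in> \<I>)"

definition ideal_topological_space :: "'a topology \<Rightarrow> 'a set set \<Rightarrow> bool" where
  "ideal_topological_space X \<I> \<longleftrightarrow> ideal_on (topspace X) \<I>"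

definition local_function :: "'a topology \<Rightarrow> 'a set set \<Rightarrow> 'a set \<Rightarrow> 'a set" where
  "local_function X \<I> A = {x \<in> topspace X. \<forall>U. openin X U \<and> x \<in> U \<longrightarrow> U \<inter> A \<notin> \<I>}"

definition star_closure :: "'a topology \<Rightarrow> 'a set set \<Rightarrow> 'a set \<Rightarrow> 'a set" where
  "star_closure X \<I> A = A \<union> local_function X \<I> A"

definition Hayashi_Samuels :: "'a topology \<Rightarrow> 'a set set \<Rightarrow> bool" where
  "Hayashi_Samuels X \<I> \<longleftrightarrow> topspace X = local_function X \<I> (topspace X)"

definition pre_I_open :: "'a topology \<Rightarrow> 'a set set \<Rightarrow> 'a set \<Rightarrow> bool" where
  "pre_I_open X \<I> A \<longleftrightarrow> A \<subseteq> topspace X \<and> A \<subseteq> X interior_of (star_closure X \<I> A)"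

definition star_perfect :: "'a topology \<Rightarrow> 'a set set \<Rightarrow> 'a set \<Rightarrow> bool" where
  "star_perfect X \<I> V \<longleftrightarrow> V \<subseteq> topspace X \<and> V = local_function X \<I> V"

definition I_locally_closed :: "'a topology \<Rightarrow> 'a set set \<Rightarrow> 'a set \<Rightarrow> bool" where
  "I_locally_closed X \<I> A \<longleftrightarrow> (\<exists>U V. openin X U \<and> star_perfect X \<I> V \<and> A = U \<inter> V)"

(* As in continuous_map, a function between the spaces is a function on the ambient
   types that maps topspace X into topspace Y, and preimages are taken in topspace X. *)

definition pre_I_continuous_map ::
  "'a topology \<Rightarrow> 'a set set \<Rightarrow> 'b topology \<Rightarrow> ('a \<Rightarrow> 'b) \<Rightarrow> bool" where
  "pre_I_continuous_map X \<I> Y f \<longleftrightarrow>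
     f \<in> topspace X \<rightarrow> topspace Y \<and>
     (\<forall>V. openin Y V \<longrightarrow> pre_I_open X \<I> {x \<in> topspace X. f x \<in> V})"

definition I_LC_continuous_map ::
  "'a topology \<Rightarrow> 'a set set \<Rightarrow> 'b topology \<Rightarrow> ('a \<Rightarrow> 'b) \<Rightarrow> bool" where
  "I_LC_continuous_map X \<I> Y f \<longleftrightarrow>
     f \<in> topspace X \<rightarrow> topspace Y \<and>
     (\<forall>V. openin Y V \<longrightarrow> I_locally_closed X \<I> {x \<in> topspace X. f x \<in> V})"

end

theory Submission
  imports Defs
begin

text \<open>
  A set is open iff it is both pre-\<open>\<I>\<close>-open and \<open>\<I>\<close>-locally closed. If \<open>A = U \<inter> V\<close> with
  \<open>V = V\<^sup>*\<close>, then \<open>Cl\<^sup>*(A) \<subseteq> V\<close> by monotonicity of the local function, so pre-\<open>\<I>\<close>-openness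
  forces \<open>A = U \<inter> Int V\<close>. Conversely, an open \<open>A\<close> is \<open>A \<inter> X\<close>, and \<open>X\<close> is \<open>\<star>\<close>-perfect
  exactly because the space is Hayashi-Samuels.
\<close>

text \<open>Heredity of the ideal: if \<open>U \<inter> B\<close> is in \<open>\<I>\<close>, so is
  its subset \<open>U \<inter> A\<close>, hence a point outside the larger local function is outside
  the smaller one.\<close>

lemma local_function_mono:
  assumes "ideal_topological_space X \<I>" and "A \<subseteq> B"
  shows "local_function X \<I> A \<subseteq> local_function X \<I> B"
proof -
  have down: "D \<in> \<I>" if "C \<in> \<I>" "D \<subseteq> C" for C D
    using assms(1) that unfolding ideal_topological_space_def ideal_on_def by blast
  have "U \<inter> A \<in> \<I>" if "U \<inter> B \<in> \<I>" for U
    using down[OF that] assms(2) by auto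
  then show ?thesis
    unfolding local_function_def by blast
qed

text \<open>An open \<open>A\<close> inside \<open>star_closure X \<I> A\<close> lies in its
  interior, the largest open subset.\<close>

lemma openin_imp_pre_I_open:
  assumes "openin X A"
  shows "pre_I_open X \<I> A"
  unfolding pre_I_open_def star_closure_def
  by (simp add: assms interior_of_maximal openin_subset)

lemma openin_imp_I_locally_closed:
  assumes "Hayashi_Samuels X \<I>" and "openin X A"
  shows "I_locally_closed X \<I> A"
proof -
  have "star_perfect X \<I> (topspace X)"
    unfolding star_perfect_def
    using assms(1)[unfolded Hayashi_Samuels_def] by (intro conjI order_refl)
  moreover have "A = A \<inter> topspace X"
    using openin_subset[OF assms(2)] by blast
  ultimately show ?thesis
    using assms(2) unfolding I_locally_closed_def by blast
qed

lemma pre_I_open_I_locally_closed_imp_openin: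
  assumes ideal: "ideal_topological_space X \<I>"
    and pre: "pre_I_open X \<I> A" and lc: "I_locally_closed X \<I> A"
  shows "openin X A"
proof -
  obtain U V where U: "openin X U" and V: "star_perfect X \<I> V" and A: "A = U \<inter> V"
    using lc unfolding I_locally_closed_def by blast
  have "local_function X \<I> V \<subseteq> V"
    using V[unfolded star_perfect_def] by (rule equalityD2[OF conjunct2])
  moreover have "local_function X \<I> A \<subseteq> local_function X \<I> V"
    using local_function_mono[OF ideal] A by blast
  ultimately have "star_closure X \<I> A \<subseteq> V"
    using A unfolding star_closure_def by blast
  then have "A \<subseteq> X interior_of V"
    using pre interior_of_mono[of "star_closure X \<I> A" V X] unfolding pre_I_open_def by blast
  \<comment> \<open>The reverse inclusion holds because the interior of \<open>V\<close> lies in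
    \<open>V\<close>.\<close>
  then have "A = U \<inter> X interior_of V"
    using A interior_of_subset[of X V] by blast
  then show ?thesis
    using U by (simp add: openin_Int)
qed

lemma openin_iff_pre_I_open_I_locally_closed:
  assumes "ideal_topological_space X \<I>" and "Hayashi_Samuels X \<I>"
  shows "openin X A \<longleftrightarrow> pre_I_open X \<I> A \<and> I_locally_closed X \<I> A"
proof
  assume "openin X A"
  then show "pre_I_open X \<I> A \<and> I_locally_closed X \<I> A"
    by (simp add: assms(2) openin_imp_pre_I_open openin_imp_I_locally_closed)
next
  assume "pre_I_open X \<I> A \<and> I_locally_closed X \<I> A"
  then show "openin X A"
    by (elim conjE) (rule pre_I_open_I_locally_closed_imp_openin[OF assms(1)])
qed

theorem theorem4p3:
  fixes X :: "'a topology" and \<I> :: "'a set set" and Y :: "'b topology" and f :: "'a \<Rightarrow> 'b"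
  assumes "ideal_topological_space X \<I>"
    and "Hayashi_Samuels X \<I>"
    and "f \<in> topspace X \<rightarrow> topspace Y"
  shows "continuous_map X Y f \<longleftrightarrow>
    pre_I_continuous_map X \<I> Y f \<and> I_LC_continuous_map X \<I> Y f"
  unfolding continuous_map_def pre_I_continuous_map_def I_LC_continuous_map_def
  \<comment> \<open>All three notions test the same preimages, so the equivalence for single sets is
    applied to each of them.\<close>
  by (auto simp: openin_iff_pre_I_open_I_locally_closed[OF assms(1,2)])

end
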